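(* Let $\{\varphi_i\}_{i=1}^\infty$ and $\{\psi_i\}_{i=1}^\infty$ be two frames for a Hilbert space $\mathbb{H}$. The following are equivalent: (i) the two frames are woven; (ii) the two frames are weakly woven.
   Context: A family $\{f_i\}_{i\in I}$ in a Hilbert space $\mathbb{H}$ is a frame for $\mathbb H$ with lower and upper frame bounds $A,B$ if $0<A\le B<\infty$ and $A\|x\|^2\le \sum_{i\in I}|\langle x,f_i\rangle|^2\le B\|x\|^2$ for all $x\in\mathbb{H}$. Unions of families are understood as indexed families (with multiplicity). Two frames $\{\varphi_i\}_{i=1}^\infty$, $\{\psi_i\}_{i=1}^\infty$ for $\mathbb{H}$ are woven if there are universal constants $0<A\le B<\infty$ such that for every $\sigma\subset\mathbb{N}$ (with $\sigma^c=\mathbb N\setminus\sigma$) the family $\{\varphi_i\}_{i\in\sigma}\cup\{\psi_i\}_{i\in\sigma^c}$ is a frame for $\mathbb{H}$ with lower and upper frame bounds $A$ and $B$. They are weakly woven if for every $\sigma\subset\mathbb{N}$ the family $\{\varphi_i\}_{i\in\sigma}\cup\{\psi_i\}_{i\in\sigma^c}$ is a frame for $\mathbb{H}$ (with frame bounds allowed to depend on $\sigma$). *)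

theory Defs
  imports "HOL-Analysis.Analysis"
begin

text \<open>
  The scalar field of a Hilbert space is \<open>\<real>\<close> or \<open>\<complex>\<close>. The following class, with instances
  \<^typ>\<open>real\<close> and \<^typ>\<open>complex\<close>, allows both to be treated at once. Up to isomorphism
  there are no further instances: every scalar \<open>a\<close> is a root of the real polynomial
  \<open>X\<^sup>2 - 2 (sc_re a) X + (norm a)\<^sup>2\<close>, so the field is algebraic over the reals.
\<close>

class rc_field = real_normed_field + heine_borel +
  fixes sc_cnj :: "'a \<Rightarrow> 'a"
    and sc_re :: "'a \<Rightarrow> real"
  assumes sc_cnj_add: "sc_cnj (a + b) = sc_cnj a + sc_cnj b"
    and sc_cnj_mult: "sc_cnj (a * b) = sc_cnj a * sc_cnj b"
    and mult_sc_cnj: "a * sc_cnj a = (norm a)\<^sup>2 *\<^sub>R 1"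
    and add_sc_cnj: "a + sc_cnj a = (2 * sc_re a) *\<^sub>R 1"

instantiation real :: rc_field
begin
definition sc_cnj_real :: "real \<Rightarrow> real" where "sc_cnj_real a = a"
definition sc_re_real :: "real \<Rightarrow> real" where "sc_re_real a = a"
instance
  by standard (simp_all add: sc_cnj_real_def sc_re_real_def power2_eq_square)
end

instantiation complex :: rc_field
begin
definition sc_cnj_complex :: "complex \<Rightarrow> complex" where "sc_cnj_complex = cnj"
definition sc_re_complex :: "complex \<Rightarrow> real" where "sc_re_complex = Re"
instance
  by standard (simp_all add: sc_cnj_complex_def sc_re_complex_def complex_add_cnj
      complex_norm_square scaleR_conv_of_real del: of_real_power)
end

text \<open>
  The inner product is linear in its first argument. No norm or topology is assumed on the
  type of vectors; the norm is the one induced by the inner product.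
\<close>

definition ip_norm :: "('v \<Rightarrow> 'v \<Rightarrow> 'k::rc_field) \<Rightarrow> 'v \<Rightarrow> real" where
  "ip_norm ip x = sqrt (sc_re (ip x x))"

locale inner_product_space = vector_space scale
  for scale :: "'k::rc_field \<Rightarrow> 'v::ab_group_add \<Rightarrow> 'v" +
  fixes ip :: "'v \<Rightarrow> 'v \<Rightarrow> 'k"
  assumes ip_add_left: "ip (x + y) z = ip x z + ip y z"
    and ip_scale_left: "ip (scale a x) y = a * ip x y"
    and ip_cnj_sym: "ip y x = sc_cnj (ip x y)"
    and ip_pos: "x \<noteq> 0 \<Longrightarrow> 0 < sc_re (ip x x)"

locale hilbert_space = inner_product_space scale ip
  for scale :: "'k::rc_field \<Rightarrow> 'v::ab_group_add \<Rightarrow> 'v"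
    and ip :: "'v \<Rightarrow> 'v \<Rightarrow> 'k" +
  assumes complete:
    "(\<And>e. e > 0 \<Longrightarrow> \<exists>M. \<forall>m\<ge>M. \<forall>n\<ge>M. ip_norm ip (X m - X n) < e)
      \<Longrightarrow> \<exists>l. (\<lambda>n. ip_norm ip (X n - l)) \<longlonglongrightarrow> 0"

text \<open>The library's real Hilbert spaces are an instance.\<close>

lemma hilbert_space_real:
  "hilbert_space (scaleR :: real \<Rightarrow> 'v \<Rightarrow> 'v::{real_inner,complete_space}) inner"
proof -
  have n: "ip_norm inner x = norm x" for x :: 'v
    by (simp add: ip_norm_def sc_re_real_def norm_eq_sqrt_inner)
  show ?thesis
  proof
    fix X :: "nat \<Rightarrow> 'v"
    assume *: "\<And>e. e > 0 \<Longrightarrow> \<exists>M. \<forall>m\<ge>M. \<forall>n\<ge>M. ip_norm inner (X m - X n) < e"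
    have "Cauchy X"
      unfolding Cauchy_def using * by (simp add: n dist_norm)
    then obtain l where "X \<longlonglongrightarrow> l"
      using Cauchy_convergent convergent_def by blast
    then have "(\<lambda>n. ip_norm inner (X n - l)) \<longlonglongrightarrow> 0"
      unfolding n using LIM_zero tendsto_norm_zero by blast
    then show "\<exists>l. (\<lambda>n. ip_norm inner (X n - l)) \<longlonglongrightarrow> 0" by blast
  qed (auto simp: sc_cnj_real_def sc_re_real_def scaleR_add_right scaleR_add_left
        inner_add_left inner_add_right inner_commute)
qed

lemma hilbert_space_complex:
  "hilbert_space ((*) :: complex \<Rightarrow> complex \<Rightarrow> complex) (\<lambda>x y. x * cnj y)"
proof -
  have n: "ip_norm (\<lambda>x y. x * cnj y) x = norm x" for x :: complex
    by (simp add: ip_norm_def sc_re_complex_def cmod_def power2_eq_square)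
  show ?thesis
  proof
    fix X :: "nat \<Rightarrow> complex"
    assume *: "\<And>e. e > 0 \<Longrightarrow>
      \<exists>M. \<forall>m\<ge>M. \<forall>n\<ge>M. ip_norm (\<lambda>x y. x * cnj y) (X m - X n) < e"
    have "Cauchy X"
      unfolding Cauchy_def using * by (simp add: n dist_norm)
    then obtain l where "X \<longlonglongrightarrow> l"
      using Cauchy_convergent convergent_def by blast
    then have "(\<lambda>n. ip_norm (\<lambda>x y. x * cnj y) (X n - l)) \<longlonglongrightarrow> 0"
      unfolding n using LIM_zero tendsto_norm_zero by blast
    then show "\<exists>l. (\<lambda>n. ip_norm (\<lambda>x y. x * cnj y) (X n - l)) \<longlonglongrightarrow> 0" by blast
  next
    fix x :: complex
    assume "x \<noteq> 0"
    then show "0 < sc_re (x * cnj x)"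
      by (simp add: sc_re_complex_def complex_neq_0 flip: power2_eq_square)
  qed (auto simp: sc_cnj_complex_def algebra_simps)
qed

text \<open>
  The summability clause is needed because \<^const>\<open>infsum\<close> is 0 on families that are not
  summable: it says that the series of nonnegative terms has a finite value.
\<close>

definition frame_with_bounds ::
  "('v \<Rightarrow> 'v \<Rightarrow> 'k::rc_field) \<Rightarrow> 'i set \<Rightarrow> ('i \<Rightarrow> 'v) \<Rightarrow> real \<Rightarrow> real \<Rightarrow> bool" where
  "frame_with_bounds ip I f A B \<longleftrightarrow> 0 < A \<and> A \<le> B \<and>
    (\<forall>x. (\<lambda>i. (norm (ip x (f i)))\<^sup>2) summable_on I \<and>
         A * (ip_norm ip x)\<^sup>2 \<le> (\<Sum>\<^sub>\<infinity>i\<in>I. (norm (ip x (f i)))\<^sup>2) \<and>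
         (\<Sum>\<^sub>\<infinity>i\<in>I. (norm (ip x (f i)))\<^sup>2) \<le> B * (ip_norm ip x)\<^sup>2)"

definition is_frame :: "('v \<Rightarrow> 'v \<Rightarrow> 'k::rc_field) \<Rightarrow> 'i set \<Rightarrow> ('i \<Rightarrow> 'v) \<Rightarrow> bool" where
  "is_frame ip I f \<longleftrightarrow> (\<exists>A B. frame_with_bounds ip I f A B)"

text \<open>
  The union with multiplicity of the families \<open>(\<phi> i)\<close> for \<open>i \<in> \<sigma>\<close> and \<open>(\<psi> i)\<close> for
  \<open>i \<notin> \<sigma>\<close> is \<^term>\<open>case_sum \<phi> \<psi>\<close> indexed by the disjoint union \<^term>\<open>\<sigma> <+> - \<sigma>\<close>.
\<close>

definition woven ::
  "('v \<Rightarrow> 'v \<Rightarrow> 'k::rc_field) \<Rightarrow> (nat \<Rightarrow> 'v) \<Rightarrow> (nat \<Rightarrow> 'v) \<Rightarrow> bool" where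
  "woven ip \<phi> \<psi> \<longleftrightarrow>
    (\<exists>A B. 0 < A \<and> A \<le> B \<and>
      (\<forall>\<sigma>. frame_with_bounds ip (\<sigma> <+> - \<sigma>) (case_sum \<phi> \<psi>) A B))"

definition weakly_woven ::
  "('v \<Rightarrow> 'v \<Rightarrow> 'k::rc_field) \<Rightarrow> (nat \<Rightarrow> 'v) \<Rightarrow> (nat \<Rightarrow> 'v) \<Rightarrow> bool" where
  "weakly_woven ip \<phi> \<psi> \<longleftrightarrow> (\<forall>\<sigma>. is_frame ip (\<sigma> <+> - \<sigma>) (case_sum \<phi> \<psi>))"

end

theory Submission
  imports Defs
begin

text \<open>
  Upper bounds are uniform for free: every weaving has upper bound \<open>B\<^sub>1 + B\<^sub>2\<close>, where \<open>B\<^sub>1\<close> and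
  \<open>B\<^sub>2\<close> are upper bounds of the two frames. The content is that lower bounds of all weavings force
  a common one. Write \<open>E \<sigma> x\<close> for the sum of \<open>(norm (ip x f))\<^sup>2\<close> over the weaving of \<open>\<sigma>\<close>, and
  suppose that there is no common lower bound. Compactness of the space of subsets of the natural
  numbers (\<open>konig_sets\<close>) then yields a set \<open>\<sigma>\<close>, sets \<open>\<tau> n\<close> that agree with \<open>\<sigma>\<close> below \<open>n\<close>, and
  unit vectors \<open>x n\<close> with \<open>E (\<tau> n) (x n)\<close> tending to 0. Two mechanisms lead from here to a weaving
  that is not a frame, according to whether the mass of the \<open>x n\<close> stays or escapes to infinity.

  If for some frame vector \<open>u\<close> the coefficients \<open>ip (x n) u\<close> do not tend to 0, rescale a
  subsequence so that they become 1. A weak limit \<open>z\<close> of the rescaled vectors would satisfy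
  \<open>ip z u = 1\<close> and be orthogonal to the whole weaving of \<open>\<sigma>\<close>, because any fixed index is eventually
  treated alike by \<open>\<tau> n\<close> and \<open>\<sigma>\<close>. Such a \<open>z\<close> contradicts the lower frame bound of \<open>\<sigma>\<close>. Weak
  compactness is replaced by an elementary argument: a decreasing sequence of convex sets that meet
  a fixed ball contains a strongly convergent selection, namely elements of nearly minimal norm
  (\<open>nested_convex_limit\<close>, \<open>orthogonal_vector_exists\<close>).

  Otherwise the coefficients of \<open>x n\<close> at every fixed index tend to 0. Then the essential mass of a
  suitable subsequence of the \<open>x n\<close> lies in disjoint blocks of indices, and copying the matching
  \<open>\<tau> n\<close> into each block gives one set \<open>\<rho>\<close> for which \<open>E \<rho> (x n)\<close> is arbitrarily small
  (\<open>gliding_hump\<close>). This contradicts the lower frame bound of \<open>\<rho>\<close>.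
\<close>

section \<open>Limits and gluing of subsets of the natural numbers\<close>

text \<open>
  Koenig's lemma on the binary tree of finite patterns: a pattern on the first \<open>n\<close> indices is kept
  if every \<open>P m\<close> has a member extending it, and then one of its two extensions by a digit is kept
  as well, since the \<open>P m\<close> shrink as \<open>m\<close> grows.
\<close>

lemma konig_sets:
  fixes P :: "nat \<Rightarrow> nat set \<Rightarrow> bool"
  assumes ex: "\<And>m. \<exists>\<tau>. P m \<tau>"
    and mono: "\<And>m n \<tau>. m \<le> n \<Longrightarrow> P n \<tau> \<Longrightarrow> P m \<tau>"
  shows "\<exists>\<sigma>. \<forall>n. \<exists>\<tau>. P n \<tau> \<and> (\<forall>i<n. i \<in> \<tau> \<longleftrightarrow> i \<in> \<sigma>)"
proof -
  \<comment> \<open>A pattern of length \<open>n\<close> is the set of its positions \<open>i < n\<close> with digit 1.\<close>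
  define rich where "rich = (\<lambda>n s. \<forall>m. \<exists>\<tau>. P m \<tau> \<and> \<tau> \<inter> {..<n} = s)"
  have step: "\<exists>t. rich (Suc n) t \<and> t \<inter> {..<n} = s" if "rich n s" for n s
  proof (rule ccontr)
    assume none: "\<nexists>t. rich (Suc n) t \<and> t \<inter> {..<n} = s"
    from that have s: "s \<subseteq> {..<n}"
      unfolding rich_def by blast
    then have "\<not> rich (Suc n) s" "\<not> rich (Suc n) (insert n s)"
      using none by auto
    then obtain a b where a: "\<And>\<tau>. P a \<tau> \<Longrightarrow> \<tau> \<inter> {..<Suc n} \<noteq> s"
      and b: "\<And>\<tau>. P b \<tau> \<Longrightarrow> \<tau> \<inter> {..<Suc n} \<noteq> insert n s"
      unfolding rich_def by blast
    from that obtain \<tau> where \<tau>: "P (max a b) \<tau>" "\<tau> \<inter> {..<n} = s"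
      unfolding rich_def by blast
    have "P a \<tau>" "P b \<tau>"
      using mono \<tau>(1) by (meson max.cobounded1 max.cobounded2)+
    moreover have "\<tau> \<inter> {..<Suc n} = s \<or> \<tau> \<inter> {..<Suc n} = insert n s"
      using \<tau>(2) by (auto simp: lessThan_Suc)
    ultimately show False using a b by blast
  qed
  have "rich 0 {}"
    using ex by (simp add: rich_def)
  then have "\<exists>s. \<forall>n. rich n (s n) \<and> s (Suc n) \<inter> {..<n} = s n"
    using step by (intro dependent_nat_choice) blast+
  then obtain s where s: "\<And>n. rich n (s n)" "\<And>n. s (Suc n) \<inter> {..<n} = s n"
    by blast
  define \<sigma> where "\<sigma> = (\<Union>n. s n)"
  have nested: "s (n + k) \<inter> {..<n} = s n" for n k
  proof (induction k)
    case 0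
    then show ?case using s(1)[of n] unfolding rich_def by auto
  next
    case (Suc k)
    have "s (n + Suc k) \<inter> {..<n} = s (Suc (n + k)) \<inter> {..<n + k} \<inter> {..<n}"
      by auto
    then show ?case using s(2) Suc by simp
  qed
  have \<sigma>: "\<sigma> \<inter> {..<n} = s n" for n
  proof
    show "s n \<subseteq> \<sigma> \<inter> {..<n}"
      using nested[of n 0] unfolding \<sigma>_def by auto
    have "s m \<inter> {..<n} \<subseteq> s n" for m
      using nested[of n "m - n"] nested[of m "n - m"] by (cases "n \<le> m") auto
    then show "\<sigma> \<inter> {..<n} \<subseteq> s n"
      unfolding \<sigma>_def by auto
  qed
  have "\<exists>\<tau>. P n \<tau> \<and> (\<forall>i<n. i \<in> \<tau> \<longleftrightarrow> i \<in> \<sigma>)" for n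
  proof -
    obtain \<tau> where "P n \<tau>" "\<tau> \<inter> {..<n} = s n"
      using s(1) unfolding rich_def by blast
    then show ?thesis using \<sigma>[of n] by blast
  qed
  then show ?thesis by blast
qed

text \<open>
  Think of \<open>p n\<close> and \<open>q n\<close> as distributions of mass over the indices, with \<open>\<sigma> n\<close> selecting from
  which of the two to take the mass at each index. Since the mass at fixed indices dies out, some
  late \<open>n\<close> has almost no mass before a given \<open>N\<close>, and by summability almost none after some \<open>M\<close>.
  Repeating this from \<open>M\<close> on gives consecutive blocks; the set \<open>\<tau>\<close> imitates on each block the
  choice of the \<open>n\<close> that belongs to it, so that block, head and tail all contribute little.
\<close>

lemma gliding_hump:
  fixes p q :: "nat \<Rightarrow> nat \<Rightarrow> real"
  assumes nonneg: "\<And>n i. 0 \<le> p n i" "\<And>n i. 0 \<le> q n i"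
    and summ: "\<And>n. summable (p n)" "\<And>n. summable (q n)"
    and null: "\<And>i. (\<lambda>n. p n i) \<longlonglongrightarrow> 0" "\<And>i. (\<lambda>n. q n i) \<longlonglongrightarrow> 0"
    and small: "(\<lambda>n. \<Sum>i. if i \<in> \<sigma> n then p n i else q n i) \<longlonglongrightarrow> 0"
  shows "\<exists>\<tau>. \<forall>e>0. \<exists>n. (\<Sum>i. if i \<in> \<tau> then p n i else q n i) < e"
proof -
  define w where "w = (\<lambda>n i. p n i + q n i)"
  define t where "t = (\<lambda>\<tau> n i. if i \<in> \<tau> then p n i else q n i)"
  have w: "0 \<le> w n i" "summable (w n)" for n i
    unfolding w_def using nonneg summ by (auto intro: summable_add)
  have t: "0 \<le> t \<tau> n i" "t \<tau> n i \<le> w n i" for \<tau> n i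
    unfolding t_def w_def using nonneg[of n i] by auto
  have ts: "summable (t \<tau> n)" for \<tau> n
    by (rule summable_comparison_test'[OF w(2)[of n], of 0]) (use t in simp)
  have step: "\<exists>M>N. \<exists>n. (\<Sum>i<N. w n i) < e \<and> (\<Sum>i. w n (i + M)) < e \<and> suminf (t (\<sigma> n) n) < e"
    if e: "0 < e" for N :: nat and e :: real
  proof -
    have "(\<lambda>n. \<Sum>i<N. w n i) \<longlonglongrightarrow> (\<Sum>i<N. 0 + 0)"
      unfolding w_def by (intro tendsto_intros null)
    then have "\<forall>\<^sub>F n in sequentially. (\<Sum>i<N. w n i) < e"
      using that by (intro order_tendstoD(2)) auto
    moreover have "\<forall>\<^sub>F n in sequentially. suminf (t (\<sigma> n) n) < e"
      using small that unfolding t_def by (rule order_tendstoD(2))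
    ultimately have "\<forall>\<^sub>F n in sequentially. (\<Sum>i<N. w n i) < e \<and> suminf (t (\<sigma> n) n) < e"
      by (rule eventually_conj)
    then obtain n where n: "(\<Sum>i<N. w n i) < e" "suminf (t (\<sigma> n) n) < e"
      using eventually_sequentially by auto
    obtain M0 where "\<And>M. M \<ge> M0 \<Longrightarrow> norm (\<Sum>i. w n (i + M)) < e"
      using suminf_exist_split[OF e w(2)] by blast
    then have "norm (\<Sum>i. w n (i + max M0 (Suc N))) < e"
      by simp
    with n show ?thesis
      by (intro exI[of _ "max M0 (Suc N)"]) auto
  qed
  define Q where "Q = (\<lambda>k N M. N < M \<and> (\<exists>n. (\<Sum>i<N. w n i) < 1 / Suc k
      \<and> (\<Sum>i. w n (i + M)) < 1 / Suc k \<and> suminf (t (\<sigma> n) n) < 1 / Suc k))"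
  have "\<exists>N. \<forall>k. Q k (N k) (N (Suc k))"
    using dependent_nat_choice[of "\<lambda>_ _. True" Q] step unfolding Q_def by auto
  then obtain N where N: "\<And>k. Q k (N k) (N (Suc k))"
    by blast
  then have "\<exists>n. \<forall>k. (\<Sum>i<N k. w (n k) i) < 1 / Suc k
      \<and> (\<Sum>i. w (n k) (i + N (Suc k))) < 1 / Suc k \<and> suminf (t (\<sigma> (n k)) (n k)) < 1 / Suc k"
    unfolding Q_def by (intro choice) blast
  then obtain n where head: "\<And>k. (\<Sum>i<N k. w (n k) i) < 1 / Suc k"
    and tail: "\<And>k. (\<Sum>i. w (n k) (i + N (Suc k))) < 1 / Suc k"
    and mid: "\<And>k. suminf (t (\<sigma> (n k)) (n k)) < 1 / Suc k"
    by blast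
  have "strict_mono N"
    using N unfolding Q_def by (simp add: strict_mono_Suc_iff)
  then have blocks: "k = l" if "i \<in> {N k..<N (Suc k)}" "i \<in> {N l..<N (Suc l)}" for i k l
    using that strict_mono_less[of N k "Suc l"] strict_mono_less[of N l "Suc k"] by auto
  define \<tau> where "\<tau> = (\<Union>k. \<sigma> (n k) \<inter> {N k..<N (Suc k)})"
  have \<tau>: "i \<in> \<tau> \<longleftrightarrow> i \<in> \<sigma> (n k)" if "i \<in> {N k..<N (Suc k)}" for i k
    using blocks that unfolding \<tau>_def by blast
  have bound: "suminf (t \<tau> (n k)) < 3 / Suc k" for k
  proof -
    let ?M = "N (Suc k)" and ?n = "n k"
    have sub: "{..<N k} \<union> {N k..<?M} = {..<?M}" "N k \<le> ?M"
      using \<open>strict_mono N\<close> by (auto simp: strict_mono_less_eq ivl_disj_un_one(2))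
    have "(\<Sum>i<?M. t \<tau> ?n i) = (\<Sum>i<N k. t \<tau> ?n i) + (\<Sum>i=N k..<?M. t \<tau> ?n i)"
      unfolding sub(1)[symmetric] by (rule sum.union_disjoint) auto
    also have "(\<Sum>i=N k..<?M. t \<tau> ?n i) = (\<Sum>i=N k..<?M. t (\<sigma> ?n) ?n i)"
      by (intro sum.cong) (auto simp: t_def \<tau>)
    also have "(\<Sum>i=N k..<?M. t (\<sigma> ?n) ?n i) \<le> suminf (t (\<sigma> ?n) ?n)"
      by (intro sum_le_suminf ts) (auto simp: t)
    also have "(\<Sum>i<N k. t \<tau> ?n i) \<le> (\<Sum>i<N k. w ?n i)"
      by (intro sum_mono t)
    finally have "(\<Sum>i<?M. t \<tau> ?n i) < 2 / Suc k"
      using head[of k] mid[of k] by simp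
    moreover have "(\<Sum>i. t \<tau> ?n (i + ?M)) \<le> (\<Sum>i. w ?n (i + ?M))"
      by (intro suminf_le t summable_ignore_initial_segment ts w)
    ultimately show ?thesis
      using suminf_split_initial_segment[OF ts, of \<tau> ?n ?M] tail[of k] by simp
  qed
  have "\<exists>n. suminf (t \<tau> n) < e" if e: "0 < e" for e
  proof -
    obtain k where "inverse (real (Suc k)) < e / 3"
      using reals_Archimedean[of "e / 3"] e by auto
    then have "3 / Suc k < e"
      by (simp add: field_simps)
    then show ?thesis
      using bound[of k] by (intro exI[of _ "n k"]) simp
  qed
  then show ?thesis
    unfolding t_def by blast
qed

section \<open>The induced norm\<close>

context inner_product_space
begin

lemma ip_zero_left: "ip 0 y = 0"
  using ip_add_left[of 0 0 y] by simp

lemma ip_minus_left: "ip (- x) y = - ip x y"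
  using ip_add_left[of x "- x" y] by (simp add: ip_zero_left eq_neg_iff_add_eq_0 add.commute)

lemma ip_diff_left: "ip (x - y) z = ip x z - ip y z"
  using ip_add_left[of x "- y" z] by (simp add: ip_minus_left)

lemma ip_add_right: "ip x (y + z) = ip x y + ip x z"
  by (metis ip_add_left ip_cnj_sym sc_cnj_add)

lemma ip_diff_right: "ip x (y - z) = ip x y - ip x z"
  using ip_add_right[of x "y - z" z] by simp

lemma sc_re_ip_nonneg: "0 \<le> sc_re (ip x x)"
proof (cases "x = 0")
  case True
  have "sc_cnj (0::'k) = 0"
    using sc_cnj_add[of "0::'k" 0] by simp
  then have "sc_re (0::'k) = 0"
    using add_sc_cnj[of "0::'k"] by simp
  with True show ?thesis by (simp add: ip_zero_left)
qed (use ip_pos in force)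

text \<open>
  The value of the form at \<open>(x, x)\<close> is fixed by conjugation and hence real. Identities between
  norms can therefore be read off from identities between scalars.
\<close>

lemma ip_self: "ip x x = of_real ((ip_norm ip x)\<^sup>2)"
proof -
  have "ip x x + ip x x = (2 * sc_re (ip x x)) *\<^sub>R 1"
    using add_sc_cnj[of "ip x x"] unfolding ip_cnj_sym[of x x, symmetric] .
  then have "2 *\<^sub>R ip x x = 2 *\<^sub>R of_real (sc_re (ip x x))"
    by (simp add: of_real_def scaleR_2)
  then have "ip x x = of_real (sc_re (ip x x))"
    by (subst (asm) scaleR_cancel_left) simp
  then show ?thesis
    using sc_re_ip_nonneg by (simp add: ip_norm_def)
qed

lemma ip_norm_nonneg: "0 \<le> ip_norm ip x"
  using sc_re_ip_nonneg by (simp add: ip_norm_def)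

lemma ip_norm_eq_0D: "ip_norm ip x = 0 \<Longrightarrow> x = 0"
  using ip_pos[of x] by (auto simp: ip_norm_def)

lemma ip_norm_scale: "ip_norm ip (scale a x) = norm a * ip_norm ip x"
proof -
  have "ip x (scale a x) = sc_cnj a * ip x x"
    by (metis ip_cnj_sym ip_scale_left sc_cnj_mult)
  then have "ip (scale a x) (scale a x) = a * sc_cnj a * ip x x"
    by (simp add: ip_scale_left)
  then have "of_real ((ip_norm ip (scale a x))\<^sup>2) = (of_real ((norm a * ip_norm ip x)\<^sup>2) :: 'k)"
    unfolding ip_self mult_sc_cnj by (simp add: of_real_def power_mult_distrib)
  then have "(ip_norm ip (scale a x))\<^sup>2 = (norm a * ip_norm ip x)\<^sup>2"
    by (simp only: of_real_eq_iff)
  then show ?thesis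
    by (simp add: ip_norm_nonneg power2_eq_iff_nonneg)
qed

lemma parallelogram:
  "(ip_norm ip (x + y))\<^sup>2 + (ip_norm ip (x - y))\<^sup>2 = 2 * (ip_norm ip x)\<^sup>2 + 2 * (ip_norm ip y)\<^sup>2"
proof -
  have "ip (x + y) (x + y) + ip (x - y) (x - y) = 2 * ip x x + 2 * ip y y"
    by (simp add: ip_add_left ip_add_right ip_diff_left ip_diff_right)
  then have "(of_real ((ip_norm ip (x + y))\<^sup>2 + (ip_norm ip (x - y))\<^sup>2) :: 'k)
      = of_real (2 * (ip_norm ip x)\<^sup>2 + 2 * (ip_norm ip y)\<^sup>2)"
    unfolding ip_self by simp
  then show ?thesis by (simp only: of_real_eq_iff)
qed

end

section \<open>Decreasing convex sets in a Hilbert space\<close>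

context hilbert_space
begin

text \<open>
  The squared distances \<open>d n\<close> from the origin to \<open>K n\<close> increase and are bounded, so they converge.
  Two elements of \<open>K n\<close> of nearly minimal norm have a midpoint in \<open>K n\<close> whose norm is no smaller,
  and the parallelogram law makes them close to each other. The limit \<open>z\<close>
  of such elements lies in the closure of every \<open>K n\<close>.
\<close>

lemma nested_convex_limit:
  assumes dec: "decseq K"
    and mid: "\<And>n x y. x \<in> K n \<Longrightarrow> y \<in> K n \<Longrightarrow> scale (1/2) (x + y) \<in> K n"
    and bdd: "\<And>n. \<exists>x\<in>K n. ip_norm ip x \<le> C"
  shows "\<exists>Z z. (\<forall>n. Z n \<in> K n) \<and> (\<lambda>n. ip_norm ip (Z n - z)) \<longlonglongrightarrow> 0"
proof -
  define d where "d = (\<lambda>n. INF x\<in>K n. (ip_norm ip x)\<^sup>2)"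
  have below: "bdd_below ((\<lambda>x. (ip_norm ip x)\<^sup>2) ` K n)" for n
    by (rule bdd_belowI[of _ 0]) auto
  have d_le: "d n \<le> (ip_norm ip x)\<^sup>2" if "x \<in> K n" for n x
    unfolding d_def using below that by (rule cINF_lower)
  have ne: "K n \<noteq> {}" for n
    using bdd by blast
  have "incseq d"
  proof (rule monoI)
    fix m n :: nat
    assume "m \<le> n"
    then have "K n \<subseteq> K m"
      using dec by (auto simp: decseq_def)
    then show "d m \<le> d n"
      unfolding d_def by (intro cINF_superset_mono below ne) auto
  qed
  moreover have "d n \<le> C\<^sup>2" for n
  proof -
    obtain x where "x \<in> K n" "ip_norm ip x \<le> C"
      using bdd by blast
    then show ?thesis
      using d_le ip_norm_nonneg power_mono order_trans by metis
  qed
  ultimately obtain D where D: "d \<longlonglongrightarrow> D" "\<And>n. d n \<le> D"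
    using incseq_convergent[of d "C\<^sup>2"] by blast
  have "\<exists>x\<in>K n. (ip_norm ip x)\<^sup>2 < d n + 1 / Suc n" for n
  proof -
    have "d n < d n + 1 / Suc n"
      by simp
    then show ?thesis
      unfolding d_def using cInf_lessD[of "(\<lambda>x. (ip_norm ip x)\<^sup>2) ` K n"] ne[of n] by blast
  qed
  then obtain Z where Z: "\<And>n. Z n \<in> K n" "\<And>n. (ip_norm ip (Z n))\<^sup>2 < d n + 1 / Suc n"
    by metis
  have cauchy: "(ip_norm ip (Z m - Z k))\<^sup>2 \<le> 4 * (D + 1 / Suc n - d n)" if "n \<le> m" "n \<le> k" for n m k
  proof -
    have "Z m \<in> K n" "Z k \<in> K n"
      using dec Z(1) that unfolding decseq_def by blast+
    then have "d n \<le> (ip_norm ip (scale (1/2) (Z m + Z k)))\<^sup>2"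
      by (intro d_le mid)
    then have "4 * d n \<le> (ip_norm ip (Z m + Z k))\<^sup>2"
      by (simp add: ip_norm_scale norm_divide power_divide)
    moreover have Z_le: "(ip_norm ip (Z j))\<^sup>2 \<le> D + 1 / Suc n" if "n \<le> j" for j
    proof -
      have "1 / real (Suc j) \<le> 1 / Suc n"
        using that by (simp add: field_simps)
      then show ?thesis
        using Z(2)[of j] D(2)[of j] by linarith
    qed
    ultimately show ?thesis
      using parallelogram[of "Z m" "Z k"] Z_le[OF that(1)] Z_le[OF that(2)] by argo
  qed
  have "(\<lambda>n. 4 * (D + 1 / Suc n - d n)) \<longlonglongrightarrow> 4 * (D + 0 - D)"
    by (intro tendsto_intros D LIMSEQ_Suc[OF lim_1_over_n])
  then have null: "(\<lambda>n. 4 * (D + 1 / Suc n - d n)) \<longlonglongrightarrow> 0"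
    by simp
  have "\<exists>z. (\<lambda>n. ip_norm ip (Z n - z)) \<longlonglongrightarrow> 0"
  proof (rule complete)
    fix e :: real
    assume "0 < e"
    then have "\<forall>\<^sub>F n in sequentially. 4 * (D + 1 / Suc n - d n) < e\<^sup>2"
      using null by (intro order_tendstoD(2)) auto
    then obtain M where M: "4 * (D + 1 / Suc M - d M) < e\<^sup>2"
      using eventually_sequentially by auto
    have "ip_norm ip (Z m - Z n) < e" if "M \<le> m" "M \<le> n" for m n
      using cauchy[OF that] M \<open>0 < e\<close> by (intro power_less_imp_less_base[of _ 2 e]) auto
    then show "\<exists>M. \<forall>m\<ge>M. \<forall>n\<ge>M. ip_norm ip (Z m - Z n) < e"
      by blast
  qed
  with Z(1) show ?thesis by blast
qed

text \<open>
  This stands in for passing to a weak limit of the bounded sequence \<open>y\<close>. The conditions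
  \<open>ip x u = 1\<close> and \<open>norm (ip x (c i)) \<le> \<epsilon> n\<close> for \<open>i < n\<close> cut out convex sets that decrease with
  \<open>n\<close> and contain \<open>y n\<close>; continuity of the functionals carries the conditions over to the limit.
\<close>

lemma orthogonal_vector_exists:
  fixes c :: "nat \<Rightarrow> 'v"
  assumes bu: "\<And>x. norm (ip x u) \<le> b * ip_norm ip x"
    and bc: "\<And>x i. norm (ip x (c i)) \<le> b * ip_norm ip x"
    and yu: "\<And>n. ip (y n) u = 1"
    and yC: "\<And>n. ip_norm ip (y n) \<le> C"
    and yc: "\<And>n i. i < n \<Longrightarrow> norm (ip (y n) (c i)) \<le> \<epsilon> n"
    and \<epsilon>: "decseq \<epsilon>" "\<epsilon> \<longlonglongrightarrow> 0"
  shows "\<exists>z. ip z u = 1 \<and> (\<forall>i. ip z (c i) = 0)"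
proof -
  define K where "K = (\<lambda>n. {x. ip x u = 1 \<and> (\<forall>i<n. norm (ip x (c i)) \<le> \<epsilon> n)})"
  have "\<exists>Z z. (\<forall>n. Z n \<in> K n) \<and> (\<lambda>n. ip_norm ip (Z n - z)) \<longlonglongrightarrow> 0"
  proof (rule nested_convex_limit)
    show "decseq K"
    proof (rule antimonoI)
      fix m n :: nat
      assume "m \<le> n"
      then have "\<epsilon> n \<le> \<epsilon> m"
        using \<epsilon>(1) by (simp add: decseq_def)
      with \<open>m \<le> n\<close> show "K n \<le> K m"
        unfolding K_def by (auto intro: order_trans dest: less_le_trans)
    qed
    show "scale (1/2) (x + y) \<in> K n" if "x \<in> K n" "y \<in> K n" for n x y
    proof -
      have "norm (ip (scale (1/2) (x + y)) (c i)) \<le> \<epsilon> n" if "i < n" for i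
      proof -
        have "norm (ip x (c i)) \<le> \<epsilon> n" "norm (ip y (c i)) \<le> \<epsilon> n"
          using \<open>x \<in> K n\<close> \<open>y \<in> K n\<close> that by (auto simp: K_def)
        then show ?thesis
          using norm_triangle_ineq[of "ip x (c i)" "ip y (c i)"]
          by (simp add: ip_scale_left ip_add_left norm_mult norm_divide)
      qed
      with that show ?thesis
        by (simp add: K_def ip_scale_left ip_add_left)
    qed
    show "\<exists>x\<in>K n. ip_norm ip x \<le> C" for n
      using yu yC yc by (intro bexI[of _ "y n"]) (auto simp: K_def)
  qed
  then obtain Z z where Z: "\<And>n. Z n \<in> K n" and z: "(\<lambda>n. ip_norm ip (Z n - z)) \<longlonglongrightarrow> 0"
    by blast
  have cont: "(\<lambda>n. ip (Z n) v) \<longlonglongrightarrow> ip z v" if "\<And>x. norm (ip x v) \<le> b * ip_norm ip x" for v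
  proof (rule Lim_transform_bound[THEN LIM_zero_cancel])
    show "\<forall>\<^sub>F n in sequentially. norm (ip (Z n) v - ip z v) \<le> norm (b * ip_norm ip (Z n - z))"
      using that by (intro always_eventually allI) (metis abs_ge_self ip_diff_left order_trans real_norm_def)
    show "(\<lambda>n. b * ip_norm ip (Z n - z)) \<longlonglongrightarrow> 0"
      using tendsto_mult_right_zero[OF z] .
  qed
  have "(\<lambda>n. ip (Z n) u) \<longlonglongrightarrow> ip z u"
    by (rule cont[OF bu])
  then have "ip z u = 1"
    using Z by (simp add: K_def LIMSEQ_const_iff)
  moreover have "ip z (c i) = 0" for i
  proof (rule LIMSEQ_unique[OF cont[OF bc]])
    show "(\<lambda>n. ip (Z n) (c i)) \<longlonglongrightarrow> 0"
      by (rule Lim_null_comparison[OF _ \<epsilon>(2)])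
        (use Z in \<open>auto simp: K_def eventually_sequentially intro!: exI[of _ "Suc i"]\<close>)
  qed
  ultimately show ?thesis by blast
qed

end

section \<open>Weavings\<close>

text \<open>
  Each index contributes exactly one vector to a weaving, so the disjoint union can be indexed by
  the natural numbers again. This turns the unordered sums into series.
\<close>

definition weave :: "nat set \<Rightarrow> (nat \<Rightarrow> 'v) \<Rightarrow> (nat \<Rightarrow> 'v) \<Rightarrow> nat \<Rightarrow> 'v" where
  "weave \<sigma> \<phi> \<psi> i = (if i \<in> \<sigma> then \<phi> i else \<psi> i)"

lemma frame_disjoint_union_eq_weave:
  "frame_with_bounds ip (\<sigma> <+> - \<sigma>) (case_sum \<phi> \<psi>) A B
    \<longleftrightarrow> frame_with_bounds ip UNIV (weave \<sigma> \<phi> \<psi>) A B"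
proof -
  define g where "g = (\<lambda>i. if i \<in> \<sigma> then Inl i else Inr i :: nat + nat)"
  have bij: "bij_betw g UNIV (\<sigma> <+> - \<sigma>)"
    unfolding bij_betw_def g_def by (auto simp: inj_on_def split: if_splits)
  have g: "case_sum \<phi> \<psi> (g i) = weave \<sigma> \<phi> \<psi> i" for i
    by (simp add: g_def weave_def)
  have "((\<lambda>i. (norm (ip x (case_sum \<phi> \<psi> i)))\<^sup>2) summable_on (\<sigma> <+> - \<sigma>)) =
      ((\<lambda>i. (norm (ip x (weave \<sigma> \<phi> \<psi> i)))\<^sup>2) summable_on UNIV)" for x
    using summable_on_reindex_bij_betw[OF bij, of "\<lambda>i. (norm (ip x (case_sum \<phi> \<psi> i)))\<^sup>2"]
    by (simp add: g)
  moreover have "(\<Sum>\<^sub>\<infinity>i\<in>\<sigma> <+> - \<sigma>. (norm (ip x (case_sum \<phi> \<psi> i)))\<^sup>2) =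
      (\<Sum>\<^sub>\<infinity>i. (norm (ip x (weave \<sigma> \<phi> \<psi> i)))\<^sup>2)" for x
    using infsum_reindex_bij_betw[OF bij, of "\<lambda>i. (norm (ip x (case_sum \<phi> \<psi> i)))\<^sup>2"]
    by (simp add: g)
  ultimately show ?thesis
    unfolding frame_with_bounds_def by simp
qed

lemma frame_nat_iff:
  fixes f :: "nat \<Rightarrow> 'v"
  shows "frame_with_bounds ip UNIV f A B \<longleftrightarrow> 0 < A \<and> A \<le> B \<and>
    (\<forall>x. summable (\<lambda>i. (norm (ip x (f i)))\<^sup>2) \<and>
         A * (ip_norm ip x)\<^sup>2 \<le> (\<Sum>i. (norm (ip x (f i)))\<^sup>2) \<and>
         (\<Sum>i. (norm (ip x (f i)))\<^sup>2) \<le> B * (ip_norm ip x)\<^sup>2)"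
proof -
  have s: "(\<lambda>i. (norm (ip x (f i)))\<^sup>2) summable_on UNIV \<longleftrightarrow> summable (\<lambda>i. (norm (ip x (f i)))\<^sup>2)" for x
    by (rule summable_on_UNIV_nonneg_real_iff) simp
  have "(\<Sum>\<^sub>\<infinity>i. (norm (ip x (f i)))\<^sup>2) = (\<Sum>i. (norm (ip x (f i)))\<^sup>2)"
    if "summable (\<lambda>i. (norm (ip x (f i)))\<^sup>2)" for x
    using that by (metis s has_sum_imp_sums has_sum_infsum sums_unique)
  with s show ?thesis
    unfolding frame_with_bounds_def by (metis (no_types, lifting))
qed

lemma frame_coefficient_bound:
  fixes f :: "nat \<Rightarrow> 'v"
  assumes "frame_with_bounds ip UNIV f A B" and "0 \<le> ip_norm ip x"
  shows "norm (ip x (f i)) \<le> sqrt B * ip_norm ip x"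
proof -
  have "(norm (ip x (f i)))\<^sup>2 \<le> (\<Sum>i. (norm (ip x (f i)))\<^sup>2)"
    using assms(1) sum_le_suminf[of "\<lambda>i. (norm (ip x (f i)))\<^sup>2" "{i}"] by (simp add: frame_nat_iff)
  also have "\<dots> \<le> B * (ip_norm ip x)\<^sup>2"
    using assms(1) by (simp add: frame_nat_iff)
  finally have "sqrt ((norm (ip x (f i)))\<^sup>2) \<le> sqrt (B * (ip_norm ip x)\<^sup>2)"
    by (rule real_sqrt_le_mono)
  then show ?thesis
    using assms(2) by (simp add: real_sqrt_mult)
qed

lemma weave_energy_upper:
  assumes \<phi>: "frame_with_bounds ip UNIV \<phi> A\<^sub>1 B\<^sub>1"
    and \<psi>: "frame_with_bounds ip UNIV \<psi> A\<^sub>2 B\<^sub>2"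
  shows "summable (\<lambda>i. (norm (ip x (weave \<sigma> \<phi> \<psi> i)))\<^sup>2)"
    and "(\<Sum>i. (norm (ip x (weave \<sigma> \<phi> \<psi> i)))\<^sup>2) \<le> (B\<^sub>1 + B\<^sub>2) * (ip_norm ip x)\<^sup>2"
proof -
  let ?p = "\<lambda>i. (norm (ip x (\<phi> i)))\<^sup>2" and ?q = "\<lambda>i. (norm (ip x (\<psi> i)))\<^sup>2"
    and ?t = "\<lambda>i. (norm (ip x (weave \<sigma> \<phi> \<psi> i)))\<^sup>2"
  have s: "summable ?p" "summable ?q"
    using \<phi> \<psi> by (simp_all add: frame_nat_iff)
  have le: "?t i \<le> ?p i + ?q i" for i
    by (simp add: weave_def)
  show t: "summable ?t"
    by (rule summable_comparison_test'[OF summable_add[OF s], of 0]) (use le in simp)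
  have "suminf ?t \<le> suminf ?p + suminf ?q"
    unfolding suminf_add[OF s] by (intro suminf_le le t summable_add s)
  also have "\<dots> \<le> (B\<^sub>1 + B\<^sub>2) * (ip_norm ip x)\<^sup>2"
    using \<phi> \<psi> unfolding distrib_right by (intro add_mono) (simp_all add: frame_nat_iff)
  finally show "suminf ?t \<le> (B\<^sub>1 + B\<^sub>2) * (ip_norm ip x)\<^sup>2" .
qed

section \<open>A uniform lower bound\<close>

context hilbert_space
begin

text \<open>
  A coefficient that did not tend to 0 could be normalised to 1 along a subsequence. The limit
  vector of \<open>orthogonal_vector_exists\<close> would then be nonzero and orthogonal to the weaving of \<open>\<sigma>\<close>.
\<close>

lemma convergent_weavings_coefficients_null:
  fixes u :: 'v
  assumes bu: "\<And>x. norm (ip x u) \<le> b * ip_norm ip x"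
    and frame: "frame_with_bounds ip UNIV (weave \<sigma> \<phi> \<psi>) A B"
    and x: "\<And>n. ip_norm ip (x n) = 1"
    and agree: "\<And>n i. i < n \<Longrightarrow> i \<in> \<tau> n \<longleftrightarrow> i \<in> \<sigma>"
    and summ: "\<And>n. summable (\<lambda>i. (norm (ip (x n) (weave (\<tau> n) \<phi> \<psi> i)))\<^sup>2)"
    and small: "\<And>n. (\<Sum>i. (norm (ip (x n) (weave (\<tau> n) \<phi> \<psi> i)))\<^sup>2) \<le> (1 / Suc n)\<^sup>2"
  shows "(\<lambda>n. ip (x n) u) \<longlonglongrightarrow> 0"
proof (rule ccontr)
  assume "\<not> (\<lambda>n. ip (x n) u) \<longlonglongrightarrow> 0"
  then obtain \<delta> where \<delta>: "0 < \<delta>" and inf: "\<And>m. \<exists>n\<ge>m. \<delta> \<le> norm (ip (x n) u)"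
    unfolding lim_sequentially dist_norm by (auto simp: not_less)
  then obtain r where r: "\<And>m. m \<le> r m" "\<And>m. \<delta> \<le> norm (ip (x (r m)) u)"
    by metis
  define y where "y = (\<lambda>m. scale (1 / ip (x (r m)) u) (x (r m)))"
  have coeff: "norm (ip (x (r m)) (weave \<sigma> \<phi> \<psi> i)) \<le> 1 / Suc m" if "i < m" for m i
  proof -
    let ?t = "\<lambda>i. (norm (ip (x (r m)) (weave (\<tau> (r m)) \<phi> \<psi> i)))\<^sup>2"
    have "i < r m"
      using that r(1)[of m] by simp
    then have "(norm (ip (x (r m)) (weave \<sigma> \<phi> \<psi> i)))\<^sup>2 = ?t i"
      using agree by (simp add: weave_def)
    also have "\<dots> \<le> suminf ?t"
      using sum_le_suminf[OF summ[of "r m"], of "{i}"] by simp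
    also have "\<dots> \<le> (1 / Suc (r m))\<^sup>2"
      by (rule small)
    finally have "norm (ip (x (r m)) (weave \<sigma> \<phi> \<psi> i)) \<le> 1 / Suc (r m)"
      by (rule power2_le_imp_le) simp
    also have "\<dots> \<le> 1 / Suc m"
      using r(1)[of m] by (intro divide_left_mono) auto
    finally show ?thesis .
  qed
  have inv: "1 / norm (ip (x (r m)) u) \<le> 1 / \<delta>" "ip (x (r m)) u \<noteq> 0" for m
    using r(2)[of m] \<delta> by (auto simp: frac_le)
  \<comment> \<open>One constant that bounds the functional of \<open>u\<close> and those of the weaving.\<close>
  let ?b = "max b (sqrt B)"
  have "\<exists>z. ip z u = 1 \<and> (\<forall>i. ip z (weave \<sigma> \<phi> \<psi> i) = 0)"
  proof (rule orthogonal_vector_exists)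
    show "norm (ip v u) \<le> ?b * ip_norm ip v" for v
      using bu[of v] ip_norm_nonneg[of v] by (meson max.cobounded1 mult_right_mono order_trans)
    show "norm (ip v (weave \<sigma> \<phi> \<psi> i)) \<le> ?b * ip_norm ip v" for v i
      using frame_coefficient_bound[OF frame ip_norm_nonneg, of v i] ip_norm_nonneg[of v]
      by (meson max.cobounded2 mult_right_mono order_trans)
    show "ip (y n) u = 1" for n
      using inv by (simp add: y_def ip_scale_left)
    show "ip_norm ip (y n) \<le> 1 / \<delta>" for n
      using inv(1)[of n] by (simp add: y_def ip_norm_scale x norm_divide)
    show "norm (ip (y n) (weave \<sigma> \<phi> \<psi> i)) \<le> 1 / \<delta> * (1 / Suc n)" if "i < n" for n i
      using mult_mono[OF inv(1)[of n] coeff[OF that]] \<delta>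
      by (simp add: y_def ip_scale_left norm_mult norm_divide)
    show "decseq (\<lambda>n. 1 / \<delta> * (1 / Suc n))"
      using \<delta> by (intro antimonoI mult_left_mono) (auto intro!: divide_left_mono)
    show "(\<lambda>n. 1 / \<delta> * (1 / Suc n)) \<longlonglongrightarrow> 0"
      by (intro tendsto_mult_right_zero LIMSEQ_Suc[OF lim_1_over_n])
  qed
  then obtain z where z: "ip z u = 1" "\<And>i. ip z (weave \<sigma> \<phi> \<psi> i) = 0"
    by blast
  have "0 < A" "A * (ip_norm ip z)\<^sup>2 \<le> (\<Sum>i. (norm (ip z (weave \<sigma> \<phi> \<psi> i)))\<^sup>2)"
    using frame by (simp_all add: frame_nat_iff)
  then have "0 < A" "A * (ip_norm ip z)\<^sup>2 \<le> 0"
    by (simp_all add: z(2))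
  then have "ip_norm ip z = 0"
    by (simp add: mult_le_0_iff)
  then show False
    using z(1) ip_norm_eq_0D ip_zero_left by fastforce
qed

text \<open>
  Without a common lower bound there are unit vectors of vanishing energy along sets converging to
  some \<open>\<sigma>\<close>. The frame property of \<open>\<sigma>\<close> forces their mass to escape to infinity, and then a gliding
  hump collects them into a single weaving without a lower bound. The weak hypothesis is thus used
  for two sets, the limit \<open>\<sigma>\<close> and the glued set \<open>\<rho>\<close>.
\<close>

lemma weakly_woven_uniform_lower_bound:
  assumes \<phi>: "frame_with_bounds ip UNIV \<phi> A\<^sub>1 B\<^sub>1"
    and \<psi>: "frame_with_bounds ip UNIV \<psi> A\<^sub>2 B\<^sub>2"
    and weak: "\<And>\<sigma>. is_frame ip UNIV (weave \<sigma> \<phi> \<psi>)"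
  shows "\<exists>A>0. \<forall>\<sigma> x. A * (ip_norm ip x)\<^sup>2 \<le> (\<Sum>i. (norm (ip x (weave \<sigma> \<phi> \<psi> i)))\<^sup>2)"
proof (rule ccontr)
  define E where "E = (\<lambda>\<sigma> x. \<Sum>i. (norm (ip x (weave \<sigma> \<phi> \<psi> i)))\<^sup>2)"
  note summ = weave_energy_upper(1)[OF \<phi> \<psi>]
  assume "\<not> (\<exists>A>0. \<forall>\<sigma> x. A * (ip_norm ip x)\<^sup>2 \<le> (\<Sum>i. (norm (ip x (weave \<sigma> \<phi> \<psi> i)))\<^sup>2))"
  then have none: "\<And>A. 0 < A \<Longrightarrow> \<exists>\<sigma> x. E \<sigma> x < A * (ip_norm ip x)\<^sup>2"
    unfolding E_def by (meson not_le)
  \<comment> \<open>The square makes the coefficients of \<open>x\<close> themselves at most \<open>1 / Suc m\<close>.\<close>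
  define P where "P = (\<lambda>m \<tau>. \<exists>x. ip_norm ip x = 1 \<and> E \<tau> x \<le> (1 / Suc m)\<^sup>2)"
  have "\<exists>\<tau>. P m \<tau>" for m
  proof -
    obtain \<tau> x where x: "E \<tau> x < (1 / Suc m)\<^sup>2 * (ip_norm ip x)\<^sup>2"
      using none[of "(1 / Suc m)\<^sup>2"] by auto
    have "0 \<le> E \<tau> x"
      unfolding E_def by (intro suminf_nonneg summ) simp
    with x have pos: "0 < ip_norm ip x"
      using ip_norm_nonneg[of x] by (cases "ip_norm ip x = 0") auto
    define a where "a = (of_real (1 / ip_norm ip x) :: 'k)"
    have na: "norm a = 1 / ip_norm ip x"
      using pos by (simp add: a_def norm_divide)
    have "E \<tau> (scale a x) = (norm a)\<^sup>2 * E \<tau> x"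
      unfolding E_def by (simp add: ip_scale_left norm_mult power_mult_distrib suminf_mult[OF summ])
    also have "\<dots> \<le> (1 / Suc m)\<^sup>2"
      using x pos by (simp add: na power_divide field_simps)
    finally have "E \<tau> (scale a x) \<le> (1 / Suc m)\<^sup>2" .
    moreover have "ip_norm ip (scale a x) = 1"
      using pos by (simp add: ip_norm_scale na)
    ultimately show ?thesis
      unfolding P_def by blast
  qed
  moreover have "P m \<tau>" if "m \<le> n" "P n \<tau>" for m n \<tau>
  proof -
    have "(1 / real (Suc n))\<^sup>2 \<le> (1 / Suc m)\<^sup>2"
      using that(1) by (intro power_mono divide_left_mono) auto
    then show ?thesis
      using that(2) unfolding P_def by (meson order_trans)
  qed
  ultimately obtain \<sigma> where "\<And>n. \<exists>\<tau>. P n \<tau> \<and> (\<forall>i<n. i \<in> \<tau> \<longleftrightarrow> i \<in> \<sigma>)"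
    using konig_sets[of P] by blast
  then obtain \<tau> where \<tau>: "\<And>n. P n (\<tau> n)" "\<And>n i. i < n \<Longrightarrow> i \<in> \<tau> n \<longleftrightarrow> i \<in> \<sigma>"
    by metis
  obtain x where x: "\<And>n. ip_norm ip (x n) = 1" "\<And>n. E (\<tau> n) (x n) \<le> (1 / Suc n)\<^sup>2"
    using \<tau>(1) unfolding P_def by metis
  obtain A B where frame: "frame_with_bounds ip UNIV (weave \<sigma> \<phi> \<psi>) A B"
    using weak unfolding is_frame_def by blast
  have null: "(\<lambda>n. ip (x n) u) \<longlonglongrightarrow> 0" if "\<And>v. norm (ip v u) \<le> b * ip_norm ip v" for u b
    by (rule convergent_weavings_coefficients_null[OF that frame x(1) \<tau>(2) summ x(2)[unfolded E_def]])
  have sq0: "(\<lambda>n. (norm (ip (x n) u))\<^sup>2) \<longlonglongrightarrow> 0" if "(\<lambda>n. ip (x n) u) \<longlonglongrightarrow> 0" for u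
    using tendsto_power[OF tendsto_norm_zero[OF that], of 2] by simp
  have if_weave: "(if i \<in> \<rho> then (norm (ip v (\<phi> i)))\<^sup>2 else (norm (ip v (\<psi> i)))\<^sup>2)
      = (norm (ip v (weave \<rho> \<phi> \<psi> i)))\<^sup>2" for i \<rho> v
    by (simp add: weave_def)
  have "\<exists>\<rho>. \<forall>e>0. \<exists>n. (\<Sum>i. if i \<in> \<rho> then (norm (ip (x n) (\<phi> i)))\<^sup>2 else (norm (ip (x n) (\<psi> i)))\<^sup>2) < e"
  proof (rule gliding_hump)
    show "summable (\<lambda>i. (norm (ip (x n) (\<phi> i)))\<^sup>2)" "summable (\<lambda>i. (norm (ip (x n) (\<psi> i)))\<^sup>2)" for n
      using \<phi> \<psi> by (simp_all add: frame_nat_iff)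
    show "(\<lambda>n. (norm (ip (x n) (\<phi> i)))\<^sup>2) \<longlonglongrightarrow> 0" for i
      by (intro sq0 null[OF frame_coefficient_bound[OF \<phi> ip_norm_nonneg]])
    show "(\<lambda>n. (norm (ip (x n) (\<psi> i)))\<^sup>2) \<longlonglongrightarrow> 0" for i
      by (intro sq0 null[OF frame_coefficient_bound[OF \<psi> ip_norm_nonneg]])
    show "(\<lambda>n. \<Sum>i. if i \<in> \<tau> n then (norm (ip (x n) (\<phi> i)))\<^sup>2 else (norm (ip (x n) (\<psi> i)))\<^sup>2) \<longlonglongrightarrow> 0"
      unfolding if_weave
    proof (rule tendsto_sandwich[of "\<lambda>_. 0"])
      show "(\<lambda>n. (1 / real (Suc n))\<^sup>2) \<longlonglongrightarrow> 0"
        using tendsto_power[OF LIMSEQ_Suc[OF lim_1_over_n], of 2] by (simp only: zero_power2)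
      show "\<forall>\<^sub>F n in sequentially. (\<Sum>i. (norm (ip (x n) (weave (\<tau> n) \<phi> \<psi> i)))\<^sup>2) \<le> (1 / real (Suc n))\<^sup>2"
        using x(2) unfolding E_def by (intro always_eventually allI)
      show "\<forall>\<^sub>F n in sequentially. 0 \<le> (\<Sum>i. (norm (ip (x n) (weave (\<tau> n) \<phi> \<psi> i)))\<^sup>2)"
        by (intro always_eventually allI suminf_nonneg summ) simp
    qed simp
  qed simp_all
  then obtain \<rho> where \<rho>: "\<And>e. 0 < e \<Longrightarrow> \<exists>n. E \<rho> (x n) < e"
    unfolding if_weave E_def by blast
  obtain A' B' where "frame_with_bounds ip UNIV (weave \<rho> \<phi> \<psi>) A' B'"
    using weak unfolding is_frame_def by blast
  then have "0 < A'" "\<And>v. A' * (ip_norm ip v)\<^sup>2 \<le> E \<rho> v"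
    by (simp_all add: frame_nat_iff E_def)
  then show False
    using \<rho>[of A'] x(1) by (metis mult.right_neutral not_le one_power2)
qed

end

theorem theorem4p5:
  fixes scale :: "'k::rc_field \<Rightarrow> 'v::ab_group_add \<Rightarrow> 'v"
    and ip :: "'v \<Rightarrow> 'v \<Rightarrow> 'k"
    and \<phi> \<psi> :: "nat \<Rightarrow> 'v"
  assumes "hilbert_space scale ip"
    and "is_frame ip UNIV \<phi>"
    and "is_frame ip UNIV \<psi>"
  shows "woven ip \<phi> \<psi> \<longleftrightarrow> weakly_woven ip \<phi> \<psi>"
proof
  assume "woven ip \<phi> \<psi>"
  then show "weakly_woven ip \<phi> \<psi>"
    unfolding woven_def weakly_woven_def is_frame_def by blast
next
  assume "weakly_woven ip \<phi> \<psi>"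
  then have weak: "is_frame ip UNIV (weave \<sigma> \<phi> \<psi>)" for \<sigma>
    unfolding weakly_woven_def is_frame_def frame_disjoint_union_eq_weave by blast
  obtain A\<^sub>1 B\<^sub>1 A\<^sub>2 B\<^sub>2 where \<phi>: "frame_with_bounds ip UNIV \<phi> A\<^sub>1 B\<^sub>1"
    and \<psi>: "frame_with_bounds ip UNIV \<psi> A\<^sub>2 B\<^sub>2"
    using assms(2,3) unfolding is_frame_def by blast
  obtain A where A: "0 < A"
    "\<And>\<sigma> x. A * (ip_norm ip x)\<^sup>2 \<le> (\<Sum>i. (norm (ip x (weave \<sigma> \<phi> \<psi> i)))\<^sup>2)"
    using hilbert_space.weakly_woven_uniform_lower_bound[OF assms(1) \<phi> \<psi> weak] by blast
  \<comment> \<open>The maximum gives \<open>A \<le> B\<close> also when all vectors are 0, where \<open>A\<close> is arbitrary.\<close>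
  let ?B = "max A (B\<^sub>1 + B\<^sub>2)"
  have "(\<Sum>i. (norm (ip x (weave \<sigma> \<phi> \<psi> i)))\<^sup>2) \<le> ?B * (ip_norm ip x)\<^sup>2" for \<sigma> x
  proof -
    have "(B\<^sub>1 + B\<^sub>2) * (ip_norm ip x)\<^sup>2 \<le> ?B * (ip_norm ip x)\<^sup>2"
      by (intro mult_right_mono) auto
    then show ?thesis
      using weave_energy_upper(2)[OF \<phi> \<psi>, of x \<sigma>] by linarith
  qed
  then have "frame_with_bounds ip UNIV (weave \<sigma> \<phi> \<psi>) A ?B" for \<sigma>
    using A weave_energy_upper(1)[OF \<phi> \<psi>] by (simp add: frame_nat_iff)
  then show "woven ip \<phi> \<psi>"
    unfolding woven_def frame_disjoint_union_eq_weave using A(1) by (intro exI[of _ A] exI[of _ ?B]) auto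
qed

end
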